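(* Let $\mathfrak{g}$ be a real nilpotent Lie algebra with an Einstein metric of nonzero scalar curvature. Let $Z$ be the centre of $\mathfrak{g}$ and $\mathfrak{g}^1=[\mathfrak{g},\mathfrak{g}]$. Then $Z\subset\mathfrak{g}^1$.
   Context: A metric on a real Lie algebra $\mathfrak{g}$ is a non-degenerate symmetric bilinear form on $\mathfrak{g}$ of arbitrary signature; it is identified with the left-invariant pseudoriemannian metric it defines on a Lie group with Lie algebra $\mathfrak{g}$, and its Ricci operator $\operatorname{ric}\colon\mathfrak{g}\to\mathfrak{g}$ and scalar curvature $s=\operatorname{tr}\operatorname{ric}$ are those of that left-invariant metric. The metric is Einstein if $\operatorname{ric}=\lambda\,\mathrm{Id}$ for some $\lambda\in\mathbb{R}$. *)

theory Defs
  imports "HOL-Analysis.Analysis"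
begin

text \<open>A vector space is modelled by a type of class \<^class>\<open>real_vector\<close>, with finite
  dimension as an explicit hypothesis, so that the zero space is included and no auxiliary
  inner product is present.\<close>

definition finite_dim :: "'a::real_vector itself \<Rightarrow> bool" where
  "finite_dim _ \<longleftrightarrow> (\<exists>B::'a set. finite B \<and> span B = UNIV)"

definition lin_trace :: "('a::real_vector \<Rightarrow> 'a) \<Rightarrow> real" where
  "lin_trace f =
    (let B = (SOME B. independent B \<and> span B = UNIV) in \<Sum>b\<in>B. representation B (f b) b)"


definition lie_algebra :: "('a::real_vector \<Rightarrow> 'a \<Rightarrow> 'a) \<Rightarrow> bool" where
  "lie_algebra br \<longleftrightarrow>
     finite_dim TYPE('a) \<and> bilinear br \<and> (\<forall>x. br x x = 0) \<and>
     (\<forall>x y z. br x (br y z) + br y (br z x) + br z (br x y) = 0)"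

definition centre :: "('a::real_vector \<Rightarrow> 'a \<Rightarrow> 'a) \<Rightarrow> 'a set" where
  "centre br = {z. \<forall>x. br z x = 0}"

definition derived_algebra :: "('a::real_vector \<Rightarrow> 'a \<Rightarrow> 'a) \<Rightarrow> 'a set" where
  "derived_algebra br = span {br x y | x y. True}"

primrec lower_central :: "('a::real_vector \<Rightarrow> 'a \<Rightarrow> 'a) \<Rightarrow> nat \<Rightarrow> 'a set" where
  "lower_central br 0 = UNIV"
| "lower_central br (Suc k) = span {br x y | x y. y \<in> lower_central br k}"

definition nilpotent_lie_algebra :: "('a::real_vector \<Rightarrow> 'a \<Rightarrow> 'a) \<Rightarrow> bool" where
  "nilpotent_lie_algebra br \<longleftrightarrow> lie_algebra br \<and> (\<exists>k. lower_central br k = {0})"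


definition lie_metric :: "('a::real_vector \<Rightarrow> 'a \<Rightarrow> real) \<Rightarrow> bool" where
  "lie_metric g \<longleftrightarrow>
     bilinear g \<and> (\<forall>x y. g x y = g y x) \<and> (\<forall>x. (\<forall>y. g x y = 0) \<longrightarrow> x = 0)"

text \<open>Elements of the Lie algebra stand for left-invariant vector fields.  The Levi-Civita
  connection of a left-invariant metric is left-invariant, hence is a bilinear map on the Lie
  algebra.  The functions \<open>g y z\<close> are constant on the group, so their derivatives vanish and
  compatibility with the metric reads \<open>g (\<nabla>\<^sub>x y) z + g y (\<nabla>\<^sub>x z) = 0\<close>.\<close>

definition is_levi_civita ::
    "('a::real_vector \<Rightarrow> 'a \<Rightarrow> 'a) \<Rightarrow> ('a \<Rightarrow> 'a \<Rightarrow> real) \<Rightarrow> ('a \<Rightarrow> 'a \<Rightarrow> 'a) \<Rightarrow> bool" where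
  "is_levi_civita br g D \<longleftrightarrow>
     bilinear D \<and> (\<forall>x y. D x y - D y x = br x y) \<and>
     (\<forall>x y z. g (D x y) z + g y (D x z) = 0)"

definition levi_civita ::
    "('a::real_vector \<Rightarrow> 'a \<Rightarrow> 'a) \<Rightarrow> ('a \<Rightarrow> 'a \<Rightarrow> real) \<Rightarrow> 'a \<Rightarrow> 'a \<Rightarrow> 'a" where
  "levi_civita br g = (THE D. is_levi_civita br g D)"

definition riemann ::
    "('a::real_vector \<Rightarrow> 'a \<Rightarrow> 'a) \<Rightarrow> ('a \<Rightarrow> 'a \<Rightarrow> real) \<Rightarrow> 'a \<Rightarrow> 'a \<Rightarrow> 'a \<Rightarrow> 'a" where
  "riemann br g x y z =
     (let D = levi_civita br g in D x (D y z) - D y (D x z) - D (br x y) z)"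

definition ricci_tensor ::
    "('a::real_vector \<Rightarrow> 'a \<Rightarrow> 'a) \<Rightarrow> ('a \<Rightarrow> 'a \<Rightarrow> real) \<Rightarrow> 'a \<Rightarrow> 'a \<Rightarrow> real" where
  "ricci_tensor br g y z = lin_trace (\<lambda>x. riemann br g x y z)"

definition ricci_operator ::
    "('a::real_vector \<Rightarrow> 'a \<Rightarrow> 'a) \<Rightarrow> ('a \<Rightarrow> 'a \<Rightarrow> real) \<Rightarrow> 'a \<Rightarrow> 'a" where
  "ricci_operator br g y = (THE w. \<forall>z. g w z = ricci_tensor br g y z)"

definition scalar_curvature ::
    "('a::real_vector \<Rightarrow> 'a \<Rightarrow> 'a) \<Rightarrow> ('a \<Rightarrow> 'a \<Rightarrow> real) \<Rightarrow> real" where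
  "scalar_curvature br g = lin_trace (ricci_operator br g)"

definition einstein :: "('a::real_vector \<Rightarrow> 'a \<Rightarrow> 'a) \<Rightarrow> ('a \<Rightarrow> 'a \<Rightarrow> real) \<Rightarrow> bool" where
  "einstein br g \<longleftrightarrow> (\<exists>c::real. \<forall>x. ricci_operator br g x = c *\<^sub>R x)"


lemma finite_dim_basis_finite:
  fixes C :: "'a::real_vector set"
  assumes "finite_dim TYPE('a)" "independent C"
  shows "finite C"
proof -
  obtain B :: "'a set" where "finite B" "span B = UNIV"
    using assms(1) unfolding finite_dim_def by blast
  then show ?thesis
    using real_vector.independent_span_bound[of B C] assms(2) by auto
qed

lemma finite_dim_obtain_basis:
  assumes "finite_dim TYPE('a::real_vector)"
  obtains B :: "'a::real_vector set" where "finite B" "independent B" "span B = UNIV"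
proof -
  obtain B :: "'a set" where B: "independent B" "span B = UNIV"
    using real_vector.maximal_independent_subset[of "UNIV :: 'a set"] by (metis top.extremum_uniqueI)
  then show ?thesis
    using that finite_dim_basis_finite[OF assms] by blast
qed

lemma lin_trace_eq:
  fixes f :: "'a::real_vector \<Rightarrow> 'a"
  assumes fd: "finite_dim TYPE('a)" and f: "linear f"
    and B: "independent B" "span B = UNIV"
  shows "lin_trace f = (\<Sum>b\<in>B. representation B (f b) b)"
proof -
  define C where "C = (SOME C::'a set. independent C \<and> span C = UNIV)"
  have "independent C \<and> span C = UNIV"
    unfolding C_def by (rule someI[where x = B]) (use B in simp)
  then have C: "independent C" "span C = UNIV" by auto
  have fB: "finite B" and fC: "finite C"
    using finite_dim_basis_finite[OF fd] B C by auto
  have eC: "(\<Sum>c\<in>C. representation C v c *\<^sub>R c) = v" for v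
    using real_vector.sum_representation_eq[OF C(1), of v C] C fC by auto
  have eB: "(\<Sum>b\<in>B. representation B v b *\<^sub>R b) = v" for v
    using real_vector.sum_representation_eq[OF B(1), of v B] B fB by auto
  have rB: "representation B (\<Sum>i\<in>I. k i *\<^sub>R h i) b = (\<Sum>i\<in>I. k i * representation B (h i) b)"
    for I :: "'a set" and k h b
    using B by (subst real_vector.representation_sum) (auto simp: real_vector.representation_scale)
  have rC: "representation C (\<Sum>i\<in>I. k i *\<^sub>R h i) b = (\<Sum>i\<in>I. k i * representation C (h i) b)"
    for I :: "'a set" and k h b
    using C by (subst real_vector.representation_sum) (auto simp: real_vector.representation_scale)
  have "(\<Sum>b\<in>B. representation B (f b) b)
      = (\<Sum>b\<in>B. representation B (\<Sum>c\<in>C. representation C b c *\<^sub>R f c) b)"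
  proof (rule sum.cong[OF refl])
    fix b
    have "f b = f (\<Sum>c\<in>C. representation C b c *\<^sub>R c)" by (simp add: eC)
    also have "\<dots> = (\<Sum>c\<in>C. representation C b c *\<^sub>R f c)"
      by (simp add: linear_sum[OF f] linear_cmul[OF f])
    finally show "representation B (f b) b
        = representation B (\<Sum>c\<in>C. representation C b c *\<^sub>R f c) b" by simp
  qed
  also have "\<dots> = (\<Sum>c\<in>C. \<Sum>b\<in>B. representation B (f c) b * representation C b c)"
    unfolding rB by (subst sum.swap) (simp add: mult.commute)
  also have "\<dots> = (\<Sum>c\<in>C. representation C (\<Sum>b\<in>B. representation B (f c) b *\<^sub>R b) c)"
    unfolding rC ..
  also have "\<dots> = (\<Sum>c\<in>C. representation C (f c) c)"
    by (simp add: eB)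
  finally show ?thesis
    by (simp add: lin_trace_def Let_def C_def)
qed

lemma metric_eqI:
  assumes "lie_metric g" "\<And>z. g v z = g w z"
  shows "v = w"
proof -
  have "g (v - w) z = 0" for z
    using assms(2)[of z] bilinear_lsub[of g v w z] assms(1) by (simp only: lie_metric_def diff_self)
  then show ?thesis
    using assms(1) unfolding lie_metric_def by (metis eq_iff_diff_eq_0)
qed

lemma metric_represents:
  fixes g :: "'a::real_vector \<Rightarrow> 'a \<Rightarrow> real"
  assumes fd: "finite_dim TYPE('a)" and g: "lie_metric g" and p: "linear p"
  shows "\<exists>!w. \<forall>z. g w z = p z"
proof -
  obtain B :: "'a set" where B: "finite B" "independent B" "span B = UNIV"
    using finite_dim_obtain_basis[OF fd] .
  interpret fd: finite_dimensional_vector_space "scaleR :: real \<Rightarrow> 'a \<Rightarrow> 'a" B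
    using B by unfold_locales (simp_all add: dependent_raw_def span_raw_def)
  have bg: "bilinear g" using g by (simp add: lie_metric_def)
  have eqB: "q = r" if "linear q" "linear r" "\<And>b. b \<in> B \<Longrightarrow> q b = r b" for q r :: "'a \<Rightarrow> real"
    using linear_eq_on[OF that(1,2), of _ B] that(3) B(3) by auto
  have lg: "linear (g w)" for w using bg by (simp add: bilinear_def)
  define T where "T w = (\<Sum>b\<in>B. g w b *\<^sub>R b)" for w
  have linT: "linear T"
    unfolding T_def
    by (rule linearI) (simp_all add: bilinear_ladd[OF bg] bilinear_lmul[OF bg]
        scaleR_add_left sum.distrib scaleR_sum_right)
  have coeff: "\<forall>b\<in>B. k b = l b" if "(\<Sum>b\<in>B. k b *\<^sub>R b) = (\<Sum>b\<in>B. l b *\<^sub>R b)" for k l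
  proof
    fix b assume "b \<in> B"
    have "(\<Sum>b\<in>B. (k b - l b) *\<^sub>R b) = 0"
      using that by (simp add: scaleR_diff_left sum_subtractf)
    then show "k b = l b"
      using real_vector.independentD[OF B(2,1), of "\<lambda>b. k b - l b" b] \<open>b \<in> B\<close> by auto
  qed
  have "inj T"
  proof (rule injI)
    fix v w assume "T v = T w"
    then have "\<forall>b\<in>B. g v b = g w b" unfolding T_def by (rule coeff)
    then have "g v = g w" using eqB[OF lg lg] by blast
    then show "v = w" using metric_eqI[OF g] by simp
  qed
  then have "surj T" using fd.linear_inj_imp_surj linT by (simp add: linear_def)
  then obtain w where "T w = (\<Sum>b\<in>B. p b *\<^sub>R b)" by (metis surjD)
  then have "\<forall>b\<in>B. g w b = p b" unfolding T_def by (rule coeff)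
  then have "g w = p" using eqB[OF lg p] by blast
  then show ?thesis using metric_eqI[OF g] by (metis)
qed

theorem levi_civita_exists_unique:
  fixes br :: "'a::real_vector \<Rightarrow> 'a \<Rightarrow> 'a"
  assumes L: "lie_algebra br" and g: "lie_metric g"
  shows "\<exists>!D. is_levi_civita br g D"
proof -
  have fd: "finite_dim TYPE('a)" and bb: "bilinear br" and alt: "\<And>x. br x x = 0"
    using L by (auto simp: lie_algebra_def)
  have bg: "bilinear g" and sym: "\<And>x y. g x y = g y x"
    using g by (auto simp: lie_metric_def)
  have skew: "br x y = - br y x" for x y
    using alt[of "x + y"] alt[of x] alt[of y]
    by (simp add: bilinear_ladd[OF bb] bilinear_radd[OF bb] eq_neg_iff_add_eq_0 add.commute)
  define K where "K x y z = (g (br x y) z - g (br y z) x + g (br z x) y) / 2" for x y z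
  note bl = bilinear_ladd[OF bb] bilinear_radd[OF bb] bilinear_lmul[OF bb] bilinear_rmul[OF bb]
    bilinear_ladd[OF bg] bilinear_radd[OF bg] bilinear_lmul[OF bg] bilinear_rmul[OF bg]
  have "linear (K x y)" for x y
    by (rule linearI) (simp_all add: K_def bl field_simps)
  then have ex: "\<exists>w. \<forall>z. g w z = K x y z" for x y
    using metric_represents[OF fd g] by blast
  then obtain D where D: "\<And>x y z. g (D x y) z = K x y z" by metis
  have "is_levi_civita br g D"
    unfolding is_levi_civita_def bilinear_def
  proof (intro conjI allI)
    show "linear (D x)" for x
      by (rule linearI; rule metric_eqI[OF g]) (simp_all add: bl D K_def field_simps)
    show "linear (\<lambda>x. D x y)" for y
      by (rule linearI; rule metric_eqI[OF g]) (simp_all add: bl D K_def field_simps)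
    show "D x y - D y x = br x y" for x y
    proof (rule metric_eqI[OF g])
      fix z
      show "g (D x y - D y x) z = g (br x y) z"
        using skew[of y x] skew[of z y] skew[of x z]
        by (simp add: bilinear_lsub[OF bg] D K_def bilinear_lneg[OF bg] field_simps)
    qed
    show "g (D x y) z + g y (D x z) = 0" for x y z
      using skew[of y x] skew[of z y] skew[of x z]
      by (simp add: sym[of y "D x z"] D K_def bilinear_lneg[OF bg] field_simps)
  qed
  moreover have "E = D" if E: "is_levi_civita br g E" for E
  proof (intro ext, rule metric_eqI[OF g])
    fix x y z
    have tor: "g (E u v) w - g (E v u) w = g (br u v) w" for u v w
      using E by (metis is_levi_civita_def bilinear_lsub[OF bg])
    have comp: "g (E u v) w + g (E u w) v = 0" for u v w
      using E sym by (metis is_levi_civita_def)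
    have "g (E x y) z = K x y z"
      using tor[of x y z] tor[of y z x] tor[of z x y] comp[of x y z] comp[of y z x] comp[of z x y]
      by (simp add: K_def)
    then show "g (E x y) z = g (D x y) z" by (simp add: D)
  qed
  ultimately show ?thesis by blast
qed

lemma levi_civita:
  assumes "lie_algebra br" "lie_metric g"
  shows "is_levi_civita br g (levi_civita br g)"
  unfolding levi_civita_def
  by (rule theI'[OF levi_civita_exists_unique[OF assms]])

lemma linear_ricci_tensor:
  fixes br :: "'a::real_vector \<Rightarrow> 'a \<Rightarrow> 'a"
  assumes L: "lie_algebra br" and g: "lie_metric g"
  shows "linear (ricci_tensor br g y)"
proof -
  have fd: "finite_dim TYPE('a)" and bb: "bilinear br"
    using L by (auto simp: lie_algebra_def)
  obtain B :: "'a set" where B: "finite B" "independent B" "span B = UNIV"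
    using finite_dim_obtain_basis[OF fd] .
  have bD: "bilinear (levi_civita br g)"
    using levi_civita[OF L g] by (simp add: is_levi_civita_def)
  note bl = bilinear_ladd[OF bb] bilinear_lmul[OF bb]
    bilinear_ladd[OF bD] bilinear_radd[OF bD] bilinear_lmul[OF bD] bilinear_rmul[OF bD]
  have "linear (\<lambda>x. riemann br g x y z)" for z
    by (rule linearI) (simp_all add: riemann_def Let_def bl algebra_simps)
  then have *: "ricci_tensor br g y z = (\<Sum>b\<in>B. representation B (riemann br g b y z) b)" for z
    unfolding ricci_tensor_def by (rule lin_trace_eq[OF fd _ B(2,3)])
  have add: "riemann br g b y (u + v) = riemann br g b y u + riemann br g b y v" for b u v
    by (simp add: riemann_def Let_def bl)
  have scale: "riemann br g b y (c *\<^sub>R v) = c *\<^sub>R riemann br g b y v" for b c v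
    by (simp add: riemann_def Let_def bl scaleR_diff_right)
  show ?thesis
    by (rule linearI) (simp_all add: * add scale B real_vector.representation_add
        real_vector.representation_scale sum.distrib sum_distrib_left)
qed

lemma ricci_operator:
  assumes L: "lie_algebra br" and g: "lie_metric g"
  shows "g (ricci_operator br g y) z = ricci_tensor br g y z"
proof -
  have "\<exists>!w. \<forall>z. g w z = ricci_tensor br g y z"
    using L by (intro metric_represents linear_ricci_tensor g) (auto simp: lie_algebra_def)
  from theI'[OF this] show ?thesis
    by (simp add: ricci_operator_def)
qed

end

theory Submission
  imports Defs
begin

text \<open>If a central vector \<open>z\<close> lies outside the derived algebra, some linear form
  \<open>g a\<close> vanishes on the derived algebra and takes the value 1 at \<open>z\<close>.  Then
  \<open>ric(z, a)\<close> is the trace of \<open>x \<mapsto> \<nabla>\<^sub>x \<nabla>\<^sub>z a - \<nabla>\<^sub>z \<nabla>\<^sub>x a\<close>.  With \<open>u = \<nabla>\<^sub>z a\<close>, the first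
  term is \<open>\<nabla>\<^sub>u x + [x, u]\<close>, the sum of a skew and a nilpotent operator of \<open>x\<close>.  The second is the
  composition of the skew operator \<open>\<nabla>\<^sub>z\<close> with \<open>x \<mapsto> \<nabla>\<^sub>x a\<close>, which is self-adjoint because
  \<open>a\<close> is orthogonal to all brackets.  Both are traceless, so \<open>ric(z, a) = 0\<close> although
  \<open>g(z, a) = 1\<close>, and the Einstein constant vanishes.\<close>

section \<open>Traces of linear maps in finite dimension\<close>

lemma lin_trace_diff:
  fixes f h :: "'a::real_vector \<Rightarrow> 'a"
  assumes fd: "finite_dim TYPE('a)" and "linear f" "linear h"
  shows "lin_trace (\<lambda>x. f x - h x) = lin_trace f - lin_trace h"
proof -
  obtain B :: "'a set" where B: "independent B" "span B = UNIV"
    using finite_dim_obtain_basis[OF fd] .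
  show ?thesis
    using assms(2,3) B
    by (simp add: lin_trace_eq[OF fd _ B] linear_compose_sub real_vector.representation_diff
        sum_subtractf)
qed

lemma lin_trace_zero: "lin_trace (\<lambda>x. 0) = 0"
  by (simp add: lin_trace_def Let_def real_vector.representation_zero)

lemma lin_trace_commute:
  fixes f h :: "'a::real_vector \<Rightarrow> 'a"
  assumes fd: "finite_dim TYPE('a)" and f: "linear f" and h: "linear h"
  shows "lin_trace (\<lambda>x. f (h x)) = lin_trace (\<lambda>x. h (f x))"
proof -
  obtain B :: "'a set" where B: "finite B" "independent B" "span B = UNIV"
    using finite_dim_obtain_basis[OF fd] .
  have rep: "representation B (p (q b)) b
      = (\<Sum>c\<in>B. representation B (q b) c * representation B (p c) b)"
    if p: "linear p" for p q :: "'a \<Rightarrow> 'a" and b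
  proof -
    have "p (q b) = p (\<Sum>c\<in>B. representation B (q b) c *\<^sub>R c)"
      using real_vector.sum_representation_eq[OF B(2), of "q b" B] B by simp
    also have "\<dots> = (\<Sum>c\<in>B. representation B (q b) c *\<^sub>R p c)"
      by (simp add: linear_sum[OF p] linear_cmul[OF p])
    finally show ?thesis
      using B by (simp add: real_vector.representation_sum real_vector.representation_scale)
  qed
  have fh: "linear (\<lambda>x. f (h x))" and hf: "linear (\<lambda>x. h (f x))"
    using linear_compose[OF f h] linear_compose[OF h f] by (simp_all add: o_def)
  show ?thesis
    unfolding lin_trace_eq[OF fd fh B(2,3)] lin_trace_eq[OF fd hf B(2,3)]
      rep[OF f, of h] rep[OF h, of f]
    by (subst sum.swap) (simp add: mult.commute)
qed

text \<open>The matrix \<open>k\<close> is the inverse of the Gram matrix of \<open>g\<close>.\<close>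

lemma lin_trace_metric:
  fixes g :: "'a::real_vector \<Rightarrow> 'a \<Rightarrow> real"
  assumes fd: "finite_dim TYPE('a)" and g: "lie_metric g"
  obtains B :: "'a set" and k where
    "\<And>b c. k b c = k c b"
    "\<And>f. linear f \<Longrightarrow> lin_trace f = (\<Sum>b\<in>B. \<Sum>c\<in>B. k b c * g (f b) c)"
proof -
  obtain B :: "'a set" where B: "finite B" "independent B" "span B = UNIV"
    using finite_dim_obtain_basis[OF fd] .
  have bg: "bilinear g" and sym: "\<And>x y. g x y = g y x"
    using g by (auto simp: lie_metric_def)
  have "linear (\<lambda>v. representation B v b)" for b
    using B by (intro linearI)
      (simp_all add: real_vector.representation_add real_vector.representation_scale)
  then have "\<exists>w. \<forall>v. g w v = representation B v b" for b
    using metric_represents[OF fd g] by blast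
  \<comment> \<open>The vectors \<open>dual b\<close> form the basis \<open>g\<close>-dual to
    \<open>B\<close>. The matrix \<open>k\<close> is the Gram matrix of this dual basis, so it
    inherits symmetry from \<open>g\<close>.\<close>
  then obtain dual where dual: "\<And>b v. g (dual b) v = representation B v b" by metis
  define k where "k b c = g (dual b) (dual c)" for b c
  have "representation B v b = (\<Sum>c\<in>B. k b c * g v c)" for v b
  proof -
    have "representation B v b = g v (dual b)"
      by (simp add: dual sym[of v])
    also have "\<dots> = g v (\<Sum>c\<in>B. representation B (dual b) c *\<^sub>R c)"
      using real_vector.sum_representation_eq[OF B(2), of "dual b" B] B by simp
    also have "\<dots> = (\<Sum>c\<in>B. representation B (dual b) c * g v c)"
      using bg by (simp add: bilinear_def linear_sum linear_cmul)
    also have "\<dots> = (\<Sum>c\<in>B. k b c * g v c)"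
      by (simp add: k_def dual[symmetric] sym)
    finally show ?thesis .
  qed
  then have "lin_trace f = (\<Sum>b\<in>B. \<Sum>c\<in>B. k b c * g (f b) c)" if "linear f" for f
    by (simp add: lin_trace_eq[OF fd that B(2,3)])
  moreover have "k b c = k c b" for b c by (simp add: k_def sym)
  ultimately show ?thesis using that by blast
qed

text \<open>Adjointness turns \<open>g (f b) c\<close> into \<open>g (h c) b\<close>. Since
  \<open>k\<close> is symmetric, exchanging the two summation indices turns the trace of
  \<open>f\<close> into that of \<open>h\<close>.\<close>

lemma lin_trace_adjoint:
  fixes g :: "'a::real_vector \<Rightarrow> 'a \<Rightarrow> real"
  assumes fd: "finite_dim TYPE('a)" and g: "lie_metric g"
    and f: "linear f" and h: "linear h" and adj: "\<And>x y. g (f x) y = g x (h y)"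
  shows "lin_trace f = lin_trace h"
proof -
  obtain B :: "'a set" and k where k: "\<And>b c. k b c = k c b"
    and tr: "\<And>f. linear f \<Longrightarrow> lin_trace f = (\<Sum>b\<in>B. \<Sum>c\<in>B. k b c * g (f b) c)"
    using lin_trace_metric[OF fd g] by metis
  have "g (f x) y = g (h y) x" for x y
    using adj g by (simp add: lie_metric_def)
  then have "lin_trace f = (\<Sum>b\<in>B. \<Sum>c\<in>B. k c b * g (h c) b)"
    by (simp add: tr[OF f] k)
  also have "\<dots> = lin_trace h"
    unfolding tr[OF h] by (rule sum.swap)
  finally show ?thesis .
qed

text \<open>The adjoint of \<open>f\<close> is \<open>- h\<close>, written \<open>0 - h x\<close> so
  that \<open>lin_trace_diff\<close> applies. Taking \<open>h = f\<close> shows that a skew operator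
  is traceless.\<close>

lemma lin_trace_neg_adjoint:
  fixes g :: "'a::real_vector \<Rightarrow> 'a \<Rightarrow> real"
  assumes fd: "finite_dim TYPE('a)" and g: "lie_metric g"
    and f: "linear f" and h: "linear h" and adj: "\<And>x y. g (f x) y + g x (h y) = 0"
  shows "lin_trace f = - lin_trace h"
proof -
  have bg: "bilinear g" using g by (simp add: lie_metric_def)
  have lin: "linear (\<lambda>x. 0 - h x)"
    using linear_compose_neg[OF h] by simp
  have "lin_trace f = lin_trace (\<lambda>x. 0 - h x)"
  proof (rule lin_trace_adjoint[OF fd g f lin])
    show "g (f x) y = g x (0 - h y)" for x y
      using adj[of x y] by (simp add: bilinear_rneg[OF bg])
  qed
  also have "\<dots> = - lin_trace h"
    using lin_trace_diff[OF fd linear_zero h] by (simp add: lin_trace_zero)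
  finally show ?thesis .
qed

text \<open>In a basis adapted to the flag \<open>V\<close>, the matrix of \<open>f\<close> is
  strictly triangular, so its diagonal is zero.\<close>

lemma lin_trace_flag:
  fixes f :: "'a::real_vector \<Rightarrow> 'a"
  assumes fd: "finite_dim TYPE('a)" and f: "linear f"
    and V: "\<And>k. subspace (V k)" "\<And>k. V (Suc k) \<subseteq> V k" "V 0 = UNIV" "V n = {0}"
    and fV: "\<And>k x. x \<in> V k \<Longrightarrow> f x \<in> V (Suc k)"
  shows "lin_trace f = 0"
proof -
  \<comment> \<open>The adapted basis is built upwards, from the empty basis of \<open>V n\<close>
    to a basis of \<open>V 0\<close>, hence the index \<open>n - j\<close>.\<close>
  have "\<exists>C. independent C \<and> span C = V (n - j) \<and> (\<forall>c\<in>C. representation C (f c) c = 0)"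
    if "j \<le> n" for j
    using that
  proof (induction j)
    case 0
    show ?case by (rule exI[of _ "{}"]) (simp add: V real_vector.independent_empty)
  next
    case (Suc j)
    define k where "k = n - Suc j"
    have k: "n - j = Suc k" using Suc.prems by (simp add: k_def)
    obtain C where C: "independent C" "span C = V (Suc k)"
      "\<forall>c\<in>C. representation C (f c) c = 0"
      using Suc k by auto
    have "C \<subseteq> V k" using C(2) V(2) real_vector.span_superset by blast
    then obtain E where E: "C \<subseteq> E" "E \<subseteq> V k" "independent E" "V k \<subseteq> span E"
      using real_vector.maximal_independent_subset_extend C(1) by metis
    have "span E = V k"
      using E V(1)[of k] real_vector.span_minimal by blast
    moreover have "representation E (f c) c = 0" if "c \<in> E" for c
    proof -
      \<comment> \<open>This holds for new and old basis vectors alike, so all coordinates of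
        \<open>f c\<close> are those with respect to \<open>C\<close>.\<close>
      have "f c \<in> span C" using that E(2) fV C(2) by blast
      then have "representation E (f c) c = representation C (f c) c"
        using real_vector.representation_extend[OF E(3) _ E(1)] by simp
      \<comment> \<open>For \<open>c\<close> in \<open>C\<close> the induction hypothesis applies;
        for \<open>c\<close> outside \<open>C\<close> the value of \<open>representation C\<close>
        at \<open>c\<close> is 0 by default.\<close>
      then show ?thesis
        using C(3) real_vector.representation_ne_zero by metis
    qed
    ultimately show ?case using E(3) k_def by blast
  qed
  from this[of n] V(3) obtain C where "independent C" "span C = UNIV"
      "\<forall>c\<in>C. representation C (f c) c = 0"
    by auto
  then show ?thesis using lin_trace_eq[OF fd f] by simp
qed

section \<open>The lower central series as a flag for the adjoint maps\<close>

lemma subspace_lower_central: "subspace (lower_central br k)"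
  by (cases k) simp_all

lemma lower_central_Suc_subset: "lower_central br (Suc k) \<subseteq> lower_central br k"
proof (induction k)
  case (Suc k)
  then have "{br x y |x y. y \<in> lower_central br (Suc k)}
      \<subseteq> {br x y |x y. y \<in> lower_central br k}" by blast
  then show ?case by (simp only: lower_central.simps(2) real_vector.span_mono)
qed simp

lemma lin_trace_ad_nilpotent:
  assumes "nilpotent_lie_algebra br"
  shows "lin_trace (br u) = 0"
proof -
  obtain n where "lower_central br n = {0}"
    using assms by (auto simp: nilpotent_lie_algebra_def)
  moreover have "br u x \<in> lower_central br (Suc k)" if "x \<in> lower_central br k" for k x
    using that by (auto intro: real_vector.span_base)
  ultimately show ?thesis
    using assms
    by (intro lin_trace_flag[where V = "lower_central br" and n = n]
        subspace_lower_central lower_central_Suc_subset)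
      (auto simp: nilpotent_lie_algebra_def lie_algebra_def bilinear_def)
qed

text \<open>The form is the \<open>z\<close>-coordinate in a basis that contains \<open>z\<close>
  together with a basis \<open>C\<close> of \<open>span S\<close>; vectors of \<open>span S\<close>
  have coordinates only along \<open>C\<close>.\<close>

lemma linear_form_separating:
  fixes S :: "'a::real_vector set"
  assumes "z \<notin> span S"
  obtains p :: "'a \<Rightarrow> real" where "linear p" "p z = 1" "\<And>x. x \<in> span S \<Longrightarrow> p x = 0"
proof -
  obtain C where C: "C \<subseteq> span S" "independent C" "span S \<subseteq> span C"
    using real_vector.maximal_independent_subset by metis
  have zC: "z \<notin> span C"
    using assms C(1) real_vector.span_minimal real_vector.subspace_span by blast
  then have "independent (insert z C)"
    using C(2) real_vector.independent_insertI by blast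
  then obtain B where B: "insert z C \<subseteq> B" "independent B" "span B = UNIV"
    using real_vector.maximal_independent_subset_extend[of "insert z C" UNIV] by (metis subset_UNIV top.extremum_uniqueI)
  show ?thesis
  proof
    show "linear (\<lambda>v. representation B v z)"
      using B by (intro linearI)
        (simp_all add: real_vector.representation_add real_vector.representation_scale)
    show "representation B z z = 1"
      using B by (simp add: real_vector.representation_basis)
    show "representation B x z = 0" if "x \<in> span S" for x
    proof -
      have "representation B x = representation C x"
        using real_vector.representation_extend[OF B(2), of x C] B(1) C(3) that by blast
      moreover have "z \<notin> C" using zC real_vector.span_base by blast
      ultimately show ?thesis
        using real_vector.representation_ne_zero by metis
    qed
  qed
qed

section \<open>Ricci curvature in a central direction\<close>

lemma ricci_tensor_central_orthogonal:
  fixes br :: "'a::real_vector \<Rightarrow> 'a \<Rightarrow> 'a"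
  assumes nil: "nilpotent_lie_algebra br" and g: "lie_metric g"
    and z: "z \<in> centre br" and a: "\<And>x y. g a (br x y) = 0"
  shows "ricci_tensor br g z a = 0"
proof -
  define D where "D = levi_civita br g"
  have L: "lie_algebra br" using nil by (simp add: nilpotent_lie_algebra_def)
  have fd: "finite_dim TYPE('a)" and bb: "bilinear br" and alt: "\<And>x. br x x = 0"
    using L by (auto simp: lie_algebra_def)
  have skew: "br x y = - br y x" for x y
    using alt[of "x + y"] alt[of x] alt[of y]
    by (simp add: bilinear_ladd[OF bb] bilinear_radd[OF bb] eq_neg_iff_add_eq_0 add.commute)
  have bg: "bilinear g" and sym: "\<And>x y. g x y = g y x"
    using g by (auto simp: lie_metric_def)
  have bD: "bilinear D" and tor: "\<And>x y. D x y - D y x = br x y"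
    and comp: "\<And>x y w. g (D x y) w + g y (D x w) = 0"
    using levi_civita[OF L g] by (auto simp: is_levi_civita_def D_def)
  have linD: "linear (D x)" "linear (\<lambda>x. D x y)" and linb: "linear (br x)" for x y
    using bD bb by (auto simp: bilinear_def)
  \<comment> \<open>This removes the term \<open>D (br x z) a\<close> from the curvature.\<close>
  have brz: "br x z = 0" for x
  proof -
    have "br z x = 0" using z unfolding centre_def by blast
    with skew[of x z] show ?thesis by (simp only: minus_zero)
  qed
  have skew_trace: "lin_trace (D v) = 0" for v
  proof -
    have "lin_trace (D v) = - lin_trace (D v)"
      by (rule lin_trace_neg_adjoint[OF fd g linD(1) linD(1)]) (rule comp)
    then show ?thesis by linarith
  qed
  \<comment> \<open>Metric compatibility and vanishing torsion reduce the failure of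
    self-adjointness to \<open>- g a (br x y)\<close>, which is zero by the choice of
    \<open>a\<close>.\<close>
  have self_adj: "g (D x a) y = g x (D y a)" for x y
  proof -
    have "g (D x a) y - g x (D y a) = - g a (D x y) + g a (D y x)"
      using comp[of x a y] comp[of y a x] sym[of x "D y a"] by simp
    also have "\<dots> = - g a (br x y)"
      using bilinear_rsub[OF bg, of a "D x y" "D y x"] tor[of x y] by simp
    finally show ?thesis by (simp add: a)
  qed
  define u where "u = D z a"
  have lin2: "linear (\<lambda>x. D z (D x a))" "linear (\<lambda>x. D (D z x) a)"
    using linear_compose[OF linD(2) linD(1)] linear_compose[OF linD(1) linD(2)]
    by (simp_all add: o_def)
  \<comment> \<open>A skew and a self-adjoint factor: passing to the adjoint reverses their order
    and changes the sign, while cyclicity of the trace reverses the order without a sign.\<close>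
  have "lin_trace (\<lambda>x. D z (D x a)) = - lin_trace (\<lambda>x. D (D z x) a)"
  proof (rule lin_trace_neg_adjoint[OF fd g lin2])
    show "g (D z (D x a)) y + g x (D (D z y) a) = 0" for x y
      using comp[of z "D x a" y] self_adj[of x "D z y"] by simp
  qed
  moreover have "lin_trace (\<lambda>x. D z (D x a)) = lin_trace (\<lambda>x. D (D z x) a)"
    by (rule lin_trace_commute[OF fd linD])
  ultimately have t2: "lin_trace (\<lambda>x. D z (D x a)) = 0" by linarith
  \<comment> \<open>Torsion-freeness trades \<open>D x u\<close> for the skew operator
    \<open>D u\<close> and the nilpotent \<open>br u\<close>, both traceless.\<close>
  have "(\<lambda>x. D x u) = (\<lambda>x. D u x - br u x)"
  proof
    show "D x u = D u x - br u x" for x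
      unfolding tor[symmetric] by simp
  qed
  then have t1: "lin_trace (\<lambda>x. D x u) = 0"
    using lin_trace_diff[OF fd linD(1) linb, of u u]
    by (simp only: skew_trace lin_trace_ad_nilpotent[OF nil] diff_self)
  have "riemann br g x z a = D x u - D z (D x a)" for x
    by (simp add: riemann_def Let_def D_def[symmetric] u_def brz bilinear_lzero[OF bD])
  then show ?thesis
    using lin_trace_diff[OF fd linD(2) lin2(1), of u] by (simp add: ricci_tensor_def t1 t2)
qed

theorem lemma2p2:
  fixes br :: "'a::real_vector \<Rightarrow> 'a \<Rightarrow> 'a"
    and g :: "'a \<Rightarrow> 'a \<Rightarrow> real"
  assumes "nilpotent_lie_algebra br"
    and "lie_metric g"
    and "einstein br g"
    and "scalar_curvature br g \<noteq> 0"
  shows "centre br \<subseteq> derived_algebra br"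
proof (rule subsetI, rule ccontr)
  fix z assume z: "z \<in> centre br" and nz: "z \<notin> derived_algebra br"
  have L: "lie_algebra br" and fd: "finite_dim TYPE('a)"
    using assms(1) by (auto simp: nilpotent_lie_algebra_def lie_algebra_def)
  have bg: "bilinear g" and sym: "\<And>x y. g x y = g y x"
    using assms(2) by (auto simp: lie_metric_def)
  from nz[unfolded derived_algebra_def]
  obtain p :: "'a \<Rightarrow> real" where p: "linear p" "p z = 1"
    "\<And>x. x \<in> span {br x y |x y. True} \<Longrightarrow> p x = 0"
    by (rule linear_form_separating) blast
  \<comment> \<open>Nondegeneracy of \<open>g\<close> represents the separating form by a vector
    orthogonal to all brackets.\<close>
  obtain a where a: "\<And>x. g a x = p x"
    using metric_represents[OF fd assms(2) p(1)] by blast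
  obtain c where c: "\<And>x. ricci_operator br g x = c *\<^sub>R x"
    using assms(3) by (auto simp: einstein_def)
  have "g a (br x y) = 0" for x y
    unfolding a by (rule p(3)) (auto intro: real_vector.span_base)
  then have "g (ricci_operator br g z) a = 0"
    using ricci_operator[OF L assms(2)]
      ricci_tensor_central_orthogonal[OF assms(1,2) z] by simp
  \<comment> \<open>The left side of the preceding equation is \<open>c * g z a\<close>, and
    \<open>g z a = p z = 1\<close>.\<close>
  then have "c = 0"
    using p(2) a[of z] sym[of z a] by (simp add: c bilinear_lmul[OF bg])
  then have "ricci_operator br g = (\<lambda>x. 0)" using c by auto
  then show False using assms(4) by (simp add: scalar_curvature_def lin_trace_zero)
qed

end
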